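(* For any fixed positive integer $n$, the sequence $(a_{n,k})_{n/2\le k\le n}$ is log-concave, where $a_{n,k}$ is the number of $321$-avoiding involutions of length $n$ whose longest increasing subsequence has length $k$.
   Context: A finite sequence of positive real numbers $(a_k)$ is log-concave if $a_{k-1}a_{k+1}\le a_k^2$ for all indices $k$ such that $k-1$, $k$, $k+1$ are all in the index range. Here $k$ ranges over the integers in $[n/2,n]$. An involution of length $n$ is a permutation $\sigma$ of $\{1,\dots,n\}$ with $\sigma=\sigma^{-1}$; a permutation is $321$-avoiding if it has no decreasing subsequence of length $3$. *)

theory Defs
  imports Complex_Main "HOL-Combinatorics.Permutations"
begin

text \<open>
  Permutations of \<open>{1, ..., n}\<close> are functions \<open>\<sigma>\<close> with \<open>\<sigma> permutes {1..n}\<close>, hence equal to the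
  identity outside \<open>{1..n}\<close>, so that each permutation has exactly one representative.
\<close>

definition involution_of_length :: "nat \<Rightarrow> (nat \<Rightarrow> nat) \<Rightarrow> bool" where
  "involution_of_length n \<sigma> \<longleftrightarrow> \<sigma> permutes {1..n} \<and> \<sigma> = inv \<sigma>"

text \<open>
  A subsequence of \<open>\<sigma> 1, ..., \<sigma> n\<close> is given by the set \<open>I\<close> of its positions; its length is \<open>card I\<close>.
\<close>

definition increasing_subsequence :: "nat \<Rightarrow> (nat \<Rightarrow> nat) \<Rightarrow> nat set \<Rightarrow> bool" where
  "increasing_subsequence n \<sigma> I \<longleftrightarrow> I \<subseteq> {1..n} \<and> (\<forall>i\<in>I. \<forall>j\<in>I. i < j \<longrightarrow> \<sigma> i < \<sigma> j)"

definition decreasing_subsequence :: "nat \<Rightarrow> (nat \<Rightarrow> nat) \<Rightarrow> nat set \<Rightarrow> bool" where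
  "decreasing_subsequence n \<sigma> I \<longleftrightarrow> I \<subseteq> {1..n} \<and> (\<forall>i\<in>I. \<forall>j\<in>I. i < j \<longrightarrow> \<sigma> i > \<sigma> j)"

definition avoids_321 :: "nat \<Rightarrow> (nat \<Rightarrow> nat) \<Rightarrow> bool" where
  "avoids_321 n \<sigma> \<longleftrightarrow> \<not> (\<exists>I. decreasing_subsequence n \<sigma> I \<and> card I = 3)"

definition longest_increasing :: "nat \<Rightarrow> (nat \<Rightarrow> nat) \<Rightarrow> nat" where
  "longest_increasing n \<sigma> = Max {card I | I. increasing_subsequence n \<sigma> I}"

definition num_321_avoiding_involutions :: "nat \<Rightarrow> int \<Rightarrow> nat" where
  "num_321_avoiding_involutions n k =
     card {\<sigma>. involution_of_length n \<sigma> \<and> avoids_321 n \<sigma> \<and> int (longest_increasing n \<sigma>) = k}"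

text \<open>
  Log-concavity of a sequence with integer index range \<open>R\<close>. Being a notion for sequences of
  positive reals, it includes positivity of the terms. Indices are integers, so that
  \<open>k - 1\<close> is never truncated.
\<close>

definition log_concave_on :: "int set \<Rightarrow> (int \<Rightarrow> real) \<Rightarrow> bool" where
  "log_concave_on R a \<longleftrightarrow>
     (\<forall>k\<in>R. a k > 0) \<and>
     (\<forall>k. k - 1 \<in> R \<and> k \<in> R \<and> k + 1 \<in> R \<longrightarrow> a (k - 1) * a (k + 1) \<le> (a k)\<^sup>2)"

end

theory Submission
  imports Defs
begin

text \<open>
  Think of an involution as a word on \<open>1, ..., n\<close>: each 2-cycle \<open>(i j)\<close> with \<open>i < j\<close> is an arc with
  opener \<open>i\<close> and closer \<open>j\<close>. Avoiding 321 means that no arc is nested in another and that no fixed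
  point lies under an arc (\<open>avoids_321_iff\<close>). Then the openers and the fixed points together form
  an increasing subsequence, and it is a longest one because an increasing subsequence cannot use
  both ends of an arc; so the longest length is \<open>n - m\<close>, where \<open>m\<close> is the number of arcs
  (\<open>longest_increasing_eq\<close>).

  The set of closers determines such an involution (\<open>closers_determine_involution\<close>), and the sets
  that occur are exactly those for which every initial segment of \<open>1, 2, ...\<close> contains at most
  as many elements as non-elements of the set. Existence is an uncrossing argument: among all
  involutions with the given closers, one that maximises \<open>\<Sum>d. d * \<sigma> d\<close> over the closers \<open>d\<close>
  avoids 321, since any nesting can be undone by exchanging two labels, which increases the
  sum (\<open>increasing_involution_exists\<close>).

  What is left is the ballot problem: there are \<open>(n choose m) - (n choose (m - 1))\<close> such sets of size
  \<open>m\<close>. Multiplied by \<open>n + 1\<close> this is \<open>(n + 1 - 2 * m) * (n + 1 choose m)\<close>, a product of two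
  factors that are log-concave in \<open>m\<close>.
\<close>

section \<open>Involutions and their closers\<close>

definition closers :: "(nat \<Rightarrow> nat) \<Rightarrow> nat set" where
  "closers \<sigma> = {i. \<sigma> i < i}"

text \<open>
  This is 321-avoidance for involutions, in a form that refers to two positions instead of three. If
  \<open>a < b\<close> and \<open>\<sigma> a > \<sigma> b \<ge> b\<close>, then the arc from \<open>a\<close> lies over the fixed point or the arc at \<open>b\<close>.
\<close>

definition increasing_at_weak_excedances :: "(nat \<Rightarrow> nat) \<Rightarrow> bool" where
  "increasing_at_weak_excedances \<sigma> \<longleftrightarrow> (\<forall>a b. a < b \<and> b \<le> \<sigma> b \<longrightarrow> \<sigma> a < \<sigma> b)"

lemma involution_of_length_iff:
  "involution_of_length n \<sigma> \<longleftrightarrow> (\<forall>x. \<sigma> (\<sigma> x) = x) \<and> (\<forall>x. x \<notin> {1..n} \<longrightarrow> \<sigma> x = x)"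
proof
  assume "involution_of_length n \<sigma>"
  then show "(\<forall>x. \<sigma> (\<sigma> x) = x) \<and> (\<forall>x. x \<notin> {1..n} \<longrightarrow> \<sigma> x = x)"
    unfolding involution_of_length_def
    by (metis permutes_inverses(1) permutes_not_in)
next
  assume *: "(\<forall>x. \<sigma> (\<sigma> x) = x) \<and> (\<forall>x. x \<notin> {1..n} \<longrightarrow> \<sigma> x = x)"
  then have "\<sigma> permutes {1..n}" unfolding permutes_def by metis
  moreover have "inv \<sigma> = \<sigma>" by (rule inv_equality) (use * in auto)
  ultimately show "involution_of_length n \<sigma>" by (simp add: involution_of_length_def)
qed

lemma involution_twice: "involution_of_length n \<sigma> \<Longrightarrow> \<sigma> (\<sigma> x) = x"
  by (simp add: involution_of_length_iff)

lemma involution_eq_iff: "involution_of_length n \<sigma> \<Longrightarrow> \<sigma> x = \<sigma> y \<longleftrightarrow> x = y"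
  by (metis involution_twice)

lemma involution_inj_on: "involution_of_length n \<sigma> \<Longrightarrow> inj_on \<sigma> A"
  by (simp add: inj_on_def involution_eq_iff)

lemma involution_in_iff: "involution_of_length n \<sigma> \<Longrightarrow> \<sigma> x \<in> {1..n} \<longleftrightarrow> x \<in> {1..n}"
  unfolding involution_of_length_def by (metis permutes_in_image)

lemma closers_subset: "involution_of_length n \<sigma> \<Longrightarrow> closers \<sigma> \<subseteq> {1..n}"
  unfolding closers_def involution_of_length_iff by fastforce

lemma finite_closers: "involution_of_length n \<sigma> \<Longrightarrow> finite (closers \<sigma>)"
  using closers_subset finite_subset by blast

lemma finite_involutions: "finite {\<sigma>. involution_of_length n \<sigma>}"
  by (rule finite_subset[OF _ finite_permutations[of "{1..n}"]])
    (auto simp: involution_of_length_def)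

lemma involution_eqI:
  assumes "involution_of_length n \<sigma>" "involution_of_length n \<tau>"
    and "closers \<sigma> = closers \<tau>" "\<And>d. d \<in> closers \<sigma> \<Longrightarrow> \<sigma> d = \<tau> d"
  shows "\<sigma> = \<tau>"
proof
  have opener: "\<rho>' i = \<rho> i"
    if "i < \<rho> i" and inv: "involution_of_length n \<rho>" "involution_of_length n \<rho>'"
      and agree: "\<And>d. d \<in> closers \<rho> \<Longrightarrow> \<rho> d = \<rho>' d" for \<rho> \<rho>' i
  proof -
    have "\<rho> i \<in> closers \<rho>"
      using \<open>i < \<rho> i\<close> involution_twice[OF inv(1)] by (simp add: closers_def)
    then have "\<rho>' (\<rho> i) = i" using agree[of "\<rho> i"] involution_twice[OF inv(1)] by simp
    then show ?thesis using involution_twice[OF inv(2), of "\<rho> i"] by simp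
  qed
  have agree: "\<tau> d = \<sigma> d" if "d \<in> closers \<tau>" for d
    using assms(3) assms(4)[of d] that by simp
  fix i
  show "\<sigma> i = \<tau> i"
  proof (cases "i \<in> closers \<tau>")
    case True
    then show ?thesis using agree[of i] by simp
  next
    case False
    then have "i \<notin> closers \<sigma>" using assms(3) by simp
    with False have "i \<le> \<sigma> i" "i \<le> \<tau> i" by (simp_all add: closers_def)
    then consider "i < \<sigma> i" | "i < \<tau> i" | "\<sigma> i = \<tau> i" by linarith
    then show ?thesis
    proof cases
      case 1
      then show ?thesis using opener[OF _ assms(1,2,4)] by simp
    next
      case 2
      then show ?thesis using opener[OF _ assms(2,1) agree] by simp
    qed
  qed
qed

section \<open>Pattern avoidance and increasing subsequences\<close>

lemma card_3_increasing:
  fixes I :: "nat set"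
  assumes "card I = 3"
  obtains i j k where "I = {i, j, k}" "i < j" "j < k"
proof -
  have fin: "finite I" using assms by (metis card.infinite zero_neq_numeral)
  obtain xs where xs: "set xs = I" "sorted_wrt (<) xs" "length xs = card I"
    using finite_set_strict_sorted[OF fin] by blast
  then have "length xs = Suc (Suc (Suc 0))" using assms by simp
  then obtain i j k where "xs = [i, j, k]" by (auto simp: length_Suc_conv)
  then show thesis using that xs by auto
qed

text \<open>
  A fixed point \<open>b\<close> under the arc from \<open>a\<close> gives the pattern 321 at \<open>a, b, \<sigma> a\<close>, an arc from \<open>b\<close>
  nested in the arc from \<open>a\<close> gives it at \<open>a, b, \<sigma> b\<close>. Conversely, in a pattern 321 at \<open>i < j < k\<close>
  the middle position would be a closer, and then the arcs ending at \<open>j\<close> and \<open>k\<close> are nested.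
\<close>

lemma avoids_321_iff:
  assumes inv: "involution_of_length n \<sigma>"
  shows "avoids_321 n \<sigma> \<longleftrightarrow> increasing_at_weak_excedances \<sigma>"
proof
  assume avoids: "avoids_321 n \<sigma>"
  have no_321: False if "i < j" "j < k" "\<sigma> i > \<sigma> j" "\<sigma> j > \<sigma> k" "i \<in> {1..n}" "k \<in> {1..n}" for i j k
  proof -
    have "decreasing_subsequence n \<sigma> {i, j, k}"
      using that unfolding decreasing_subsequence_def by auto
    moreover have "card {i, j, k} = 3" using that by simp
    ultimately show False using avoids unfolding avoids_321_def by blast
  qed
  show "increasing_at_weak_excedances \<sigma>" unfolding increasing_at_weak_excedances_def
  proof (intro allI impI)
    fix a b assume ab: "a < b \<and> b \<le> \<sigma> b"
    show "\<sigma> a < \<sigma> b"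
    proof (rule ccontr)
      assume "\<not> \<sigma> a < \<sigma> b"
      then have gt: "\<sigma> a > \<sigma> b" using ab involution_eq_iff[OF inv, of a b] by linarith
      then have a: "a \<in> {1..n}" using ab inv unfolding involution_of_length_iff
        by (metis leD le_less_trans order.strict_trans)
      then have sa: "\<sigma> a \<in> {1..n}" using involution_in_iff[OF inv] by blast
      show False
      proof (cases "\<sigma> b = b")
        case True
        then show False
          using no_321[of a b "\<sigma> a"] ab gt a sa involution_twice[OF inv] by auto
      next
        case False
        then show False
          using no_321[of a b "\<sigma> b"] ab gt a sa involution_twice[OF inv] by auto
      qed
    qed
  qed
next
  assume incr: "increasing_at_weak_excedances \<sigma>"
  show "avoids_321 n \<sigma>" unfolding avoids_321_def
  proof
    assume "\<exists>I. decreasing_subsequence n \<sigma> I \<and> card I = 3"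
    then obtain i j k where "decreasing_subsequence n \<sigma> {i, j, k}" "i < j" "j < k"
      by (metis card_3_increasing)
    then have dec: "\<sigma> i > \<sigma> j" "\<sigma> j > \<sigma> k" "i < j" "j < k"
      unfolding decreasing_subsequence_def by auto
    then have "\<sigma> j < j" using incr unfolding increasing_at_weak_excedances_def
      by (metis linorder_not_le order.asym)
    then have "k < j"
      using incr[unfolded increasing_at_weak_excedances_def, rule_format, of "\<sigma> k" "\<sigma> j"]
        dec involution_twice[OF inv] by simp
    then show False using dec by simp
  qed
qed

text \<open>
  Both ends of an arc form a descent, so \<open>i \<mapsto> min i (\<sigma> i)\<close> is injective on an increasing
  subsequence. It takes its values outside the closers, which gives the upper bound; the
  non-closers themselves attain it.
\<close>

lemma longest_increasing_eq:
  assumes inv: "involution_of_length n \<sigma>" and incr: "increasing_at_weak_excedances \<sigma>"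
  shows "longest_increasing n \<sigma> = n - card (closers \<sigma>)"
  unfolding longest_increasing_def
proof (rule Max_eqI)
  have card_nonclosers: "card ({1..n} - closers \<sigma>) = n - card (closers \<sigma>)"
    using closers_subset[OF inv] by (simp add: card_Diff_subset finite_closers[OF inv])
  have "{card I |I. increasing_subsequence n \<sigma> I} \<subseteq> card ` Pow {1..n}"
    unfolding increasing_subsequence_def by blast
  then show "finite {card I |I. increasing_subsequence n \<sigma> I}"
    by (rule finite_subset) simp
  show "c \<le> n - card (closers \<sigma>)" if "c \<in> {card I |I. increasing_subsequence n \<sigma> I}" for c
  proof -
    from that obtain I where I: "increasing_subsequence n \<sigma> I" and c: "c = card I" by blast
    let ?f = "\<lambda>i. min i (\<sigma> i)"
    have "inj_on ?f I"
    proof (rule linorder_inj_onI')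
      fix i j assume ij: "i \<in> I" "j \<in> I" "i < j"
      then have "\<sigma> i < \<sigma> j" using I unfolding increasing_subsequence_def by blast
      then show "?f i \<noteq> ?f j"
        using ij involution_twice[OF inv, of i] involution_twice[OF inv, of j]
        by (auto simp: min_def split: if_splits)
    qed
    moreover have "?f ` I \<subseteq> {1..n} - closers \<sigma>"
    proof
      fix y assume "y \<in> ?f ` I"
      then obtain i where i: "i \<in> I" "y = ?f i" by blast
      then have "i \<in> {1..n}" using I unfolding increasing_subsequence_def by blast
      then show "y \<in> {1..n} - closers \<sigma>"
        using i involution_in_iff[OF inv, of i] involution_twice[OF inv, of i]
        by (auto simp: min_def closers_def)
    qed
    ultimately have "card I \<le> card ({1..n} - closers \<sigma>)"
      by (intro card_inj_on_le[of ?f]) auto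
    then show ?thesis using c card_nonclosers by simp
  qed
  have "increasing_subsequence n \<sigma> ({1..n} - closers \<sigma>)"
    using incr unfolding increasing_subsequence_def increasing_at_weak_excedances_def closers_def
    by auto
  then show "n - card (closers \<sigma>) \<in> {card I |I. increasing_subsequence n \<sigma> I}"
    using card_nonclosers by force
qed

section \<open>Closer sets are ballot sets\<close>

definition ballot_sets :: "nat \<Rightarrow> nat \<Rightarrow> nat set set" where
  "ballot_sets n m =
     {D. D \<subseteq> {1..n} \<and> card D = m \<and> (\<forall>j. 2 * card (D \<inter> {1..j}) \<le> j)}"

lemma ballot_prefixes_Diff:
  fixes D :: "nat set"
  assumes "finite D" "\<And>j. 2 * card (D \<inter> {1..j}) \<le> j"
  shows "2 * card ((D - A) \<inter> {1..j}) \<le> j"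
proof -
  have "card ((D - A) \<inter> {1..j}) \<le> card (D \<inter> {1..j})"
    by (rule card_mono) (use assms(1) in auto)
  then show ?thesis using assms(2)[of j] by linarith
qed

text \<open>
  Every closer in \<open>{1..j}\<close> has its opener there too.
\<close>

lemma closers_ballot:
  assumes inv: "involution_of_length n \<sigma>"
  shows "closers \<sigma> \<in> ballot_sets n (card (closers \<sigma>))"
proof -
  have "2 * card (closers \<sigma> \<inter> {1..j}) \<le> j" for j
  proof -
    let ?C = "closers \<sigma> \<inter> {1..j}"
    have "\<sigma> ` ?C \<subseteq> {1..j} - ?C"
    proof
      fix y assume "y \<in> \<sigma> ` ?C"
      then obtain d where d: "y = \<sigma> d" "\<sigma> d < d" "1 \<le> d" "d \<le> j" by (auto simp: closers_def)
      then have "d \<in> {1..n}" using closers_subset[OF inv] by (auto simp: closers_def)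
      then have "1 \<le> \<sigma> d" using involution_in_iff[OF inv, of d] by simp
      then show "y \<in> {1..j} - ?C" using d by (auto simp: closers_def involution_twice[OF inv])
    qed
    then have "card (\<sigma> ` ?C) \<le> card ({1..j} - ?C)" by (intro card_mono) auto
    moreover have "card (\<sigma> ` ?C) = card ?C"
      by (rule card_image) (rule involution_inj_on[OF inv])
    moreover have "card ({1..j} - ?C) = j - card ?C"
      by (subst card_Diff_subset) auto
    moreover have "card ?C \<le> card {1..j}" by (rule card_mono) auto
    ultimately show ?thesis by simp
  qed
  then show ?thesis using closers_subset[OF inv] by (simp add: ballot_sets_def)
qed

text \<open>
  At the largest closer \<open>d\<close> where the two involutions differ, let \<open>j\<close> be the larger of its two
  openers. The other involution has no choice for \<open>j\<close>: since it opens \<open>d\<close> before \<open>j\<close>, it must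
  close \<open>j\<close> after \<open>d\<close>, and there both involutions agree.
\<close>

lemma closers_determine_involution:
  assumes inv: "involution_of_length n \<sigma>" "involution_of_length n \<tau>"
    and incr: "increasing_at_weak_excedances \<sigma>" "increasing_at_weak_excedances \<tau>"
    and closers_eq: "closers \<sigma> = closers \<tau>"
  shows "\<sigma> = \<tau>"
proof (rule ccontr)
  assume "\<sigma> \<noteq> \<tau>"
  define E where "E = {d \<in> closers \<sigma>. \<sigma> d \<noteq> \<tau> d}"
  have "\<exists>d\<in>closers \<sigma>. \<sigma> d \<noteq> \<tau> d"
    using involution_eqI[OF inv closers_eq] \<open>\<sigma> \<noteq> \<tau>\<close> by blast
  then have "E \<noteq> {}" unfolding E_def by blast
  moreover have finE: "finite E" using finite_closers[OF inv(1)] by (simp add: E_def)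
  ultimately have d: "Max E \<in> E" and agree: "\<And>e. e > Max E \<Longrightarrow> e \<notin> E"
    by (auto simp: leD)
  \<comment> \<open>Stated for \<open>\<rho>, \<rho>'\<close> because the situation is symmetric in \<open>\<sigma>\<close> and \<open>\<tau>\<close>.\<close>
  have clash: False
    if less: "\<rho> d < \<rho>' d" and d: "\<rho>' d < d" and agree: "\<And>e. e > d \<Longrightarrow> e \<in> closers \<rho> \<Longrightarrow> \<rho> e = \<rho>' e"
      and inv: "involution_of_length n \<rho>" "involution_of_length n \<rho>'"
      and incr: "increasing_at_weak_excedances \<rho>" and closers_eq: "closers \<rho> = closers \<rho>'"
    for \<rho> \<rho>' d
  proof -
    define j where "j = \<rho>' d"
    have "j \<notin> closers \<rho>'" using d involution_twice[OF inv(2)] by (simp add: closers_def j_def)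
    then have "j \<notin> closers \<rho>" using closers_eq by simp
    then have "j \<le> \<rho> j" by (simp add: closers_def)
    then have "\<rho> (\<rho> d) < \<rho> j"
      using incr less unfolding increasing_at_weak_excedances_def j_def by blast
    then have "d < \<rho> j" using involution_twice[OF inv(1)] by simp
    moreover have "\<rho> j \<in> closers \<rho>"
      using \<open>d < \<rho> j\<close> d involution_twice[OF inv(1)] by (simp add: closers_def j_def)
    ultimately have "\<rho>' (\<rho> j) = j" using agree[of "\<rho> j"] involution_twice[OF inv(1), of j] by simp
    then have "\<rho>' (\<rho> j) = \<rho>' d" by (simp only: j_def)
    then show False using \<open>d < \<rho> j\<close> involution_eq_iff[OF inv(2)] by simp
  qed
  have in_closers: "Max E \<in> closers \<sigma>" "Max E \<in> closers \<tau>" "\<sigma> (Max E) \<noteq> \<tau> (Max E)"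
    using d closers_eq unfolding E_def by blast+
  then have below: "\<sigma> (Max E) < Max E" "\<tau> (Max E) < Max E" unfolding closers_def by blast+
  have agree_\<sigma>: "\<sigma> e = \<tau> e" if "e > Max E" "e \<in> closers \<sigma>" for e
    using agree[OF that(1)] that(2) unfolding E_def by blast
  have agree_\<tau>: "\<tau> e = \<sigma> e" if "e > Max E" "e \<in> closers \<tau>" for e
    using agree_\<sigma>[of e] that closers_eq by metis
  consider "\<sigma> (Max E) < \<tau> (Max E)" | "\<tau> (Max E) < \<sigma> (Max E)"
    using in_closers by linarith
  then show False
  proof cases
    case 1
    then show False
      by (rule clash[OF _ below(2) agree_\<sigma> inv incr(1) closers_eq])
  next
    case 2
    then show False
      by (rule clash[OF _ below(1) agree_\<tau> inv(2,1) incr(2) closers_eq[symmetric]])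
  qed
qed

text \<open>
  Arcs may nest here, so the closers can be added from left to right: by the ballot condition
  there is always a fixed point left to serve as the opener of the next one.
\<close>

lemma involution_with_closers_exists:
  assumes "D \<in> ballot_sets n m"
  shows "\<exists>\<sigma>. involution_of_length n \<sigma> \<and> closers \<sigma> = D"
  using assms
proof (induction n arbitrary: D m)
  case 0
  then have "D = {}" by (simp add: ballot_sets_def)
  then have "involution_of_length 0 id \<and> closers id = D"
    by (simp add: involution_of_length_iff closers_def)
  then show ?case by blast
next
  case (Suc n)
  have D: "D \<subseteq> {1..Suc n}" and ballot: "\<And>j. 2 * card (D \<inter> {1..j}) \<le> j"
    using Suc.prems by (auto simp: ballot_sets_def)
  have finD: "finite D" using D finite_subset by blast
  define D' where "D' = D - {Suc n}"
  have "2 * card (D' \<inter> {1..j}) \<le> j" for j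
    unfolding D'_def by (rule ballot_prefixes_Diff[OF finD ballot])
  then have "D' \<in> ballot_sets n (card D')"
    using D by (auto simp: ballot_sets_def D'_def le_Suc_eq)
  then obtain \<sigma> where inv: "involution_of_length n \<sigma>" and closers: "closers \<sigma> = D'"
    using Suc.IH by blast
  show ?case
  proof (cases "Suc n \<in> D")
    case False
    then have "D' = D" by (simp add: D'_def)
    moreover have "involution_of_length (Suc n) \<sigma>"
      using inv by (auto simp: involution_of_length_iff)
    ultimately show ?thesis using closers by blast
  next
    case True
    have "D \<inter> {1..Suc n} = insert (Suc n) D'" using D True by (auto simp: D'_def)
    then have "2 * Suc (card D') \<le> Suc n"
      using ballot[of "Suc n"] finD card_insert_disjoint[of D' "Suc n"] unfolding D'_def by simp
    moreover have "card (D' \<union> \<sigma> ` D') \<le> card D' + card D'"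
      using card_Un_le[of D' "\<sigma> ` D'"] card_image_le[of D' \<sigma>] finD by (simp add: D'_def)
    ultimately have "card (D' \<union> \<sigma> ` D') < card {1..n}" by simp
    then have "\<not> {1..n} \<subseteq> D' \<union> \<sigma> ` D'"
      using card_mono[of "D' \<union> \<sigma> ` D'" "{1..n}"] finD by (auto simp: D'_def)
    then obtain u where u: "u \<in> {1..n}" "u \<notin> D'" "u \<notin> \<sigma> ` D'" by blast
    have "\<sigma> u = u"
    proof (rule ccontr)
      assume "\<sigma> u \<noteq> u"
      then have "\<sigma> u \<in> D'"
        using u(2) involution_twice[OF inv, of u] closers by (auto simp: closers_def)
      then show False using u(3) involution_twice[OF inv, of u] by (metis image_eqI)
    qed
    have sn: "\<sigma> (Suc n) = Suc n" using inv by (simp add: involution_of_length_iff)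
    let ?\<tau> = "\<sigma>(u := Suc n, Suc n := u)"
    have "\<sigma> x = u \<longleftrightarrow> x = u" "\<sigma> x = Suc n \<longleftrightarrow> x = Suc n" for x
      using involution_twice[OF inv, of x] \<open>\<sigma> u = u\<close> sn by auto
    moreover have "\<sigma> x = x" if "x \<notin> {1..n}" for x
      using inv that by (simp add: involution_of_length_iff)
    ultimately have "involution_of_length (Suc n) ?\<tau>"
      using u involution_twice[OF inv] unfolding involution_of_length_iff by auto
    moreover have "closers ?\<tau> = insert (Suc n) (closers \<sigma>)"
      using u \<open>\<sigma> u = u\<close> by (auto simp: closers_def)
    ultimately show ?thesis using closers True
      by (metis D'_def insert_Diff)
  qed
qed

text \<open>
  The arcs can be rearranged so that none covers another arc or a fixed point. If the arc from \<open>a\<close>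
  covers \<open>b\<close>, conjugating by the transposition of \<open>a\<close> and \<open>b\<close> keeps the closers and moves the
  larger of these openers to the larger closer; if \<open>b\<close> is fixed, it becomes the
  opener of the only closer affected. Either way the sum of \<open>d * \<sigma> d\<close> over the closers grows, and
  at a maximum of this sum no such pair is left.
\<close>

lemma increasing_involution_exists:
  assumes "D \<in> ballot_sets n m"
  shows "\<exists>\<sigma>. involution_of_length n \<sigma> \<and> increasing_at_weak_excedances \<sigma> \<and> closers \<sigma> = D"
proof -
  define S where "S = {\<sigma>. involution_of_length n \<sigma> \<and> closers \<sigma> = D}"
  define w where "w = (\<lambda>\<sigma>. \<Sum>d\<in>D. d * \<sigma> d)"
  have "finite S"
    by (rule finite_subset[OF _ finite_involutions]) (auto simp: S_def)
  moreover have "S \<noteq> {}" using involution_with_closers_exists[OF assms] by (auto simp: S_def)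
  ultimately have "Max (w ` S) \<in> w ` S" by (intro Max_in) auto
  then obtain \<sigma> where \<sigma>: "\<sigma> \<in> S" "w \<sigma> = Max (w ` S)" by auto
  have maximal: "w \<tau> \<le> w \<sigma>" if "\<tau> \<in> S" for \<tau>
    unfolding \<sigma>(2) by (rule Max_ge) (use \<open>finite S\<close> that in auto)
  from \<sigma>(1) have inv: "involution_of_length n \<sigma>" and closers: "closers \<sigma> = D" by (auto simp: S_def)
  have finD: "finite D" using finite_closers[OF inv] closers by simp
  have "increasing_at_weak_excedances \<sigma>" unfolding increasing_at_weak_excedances_def
  proof (intro allI impI, rule ccontr)
    fix a b assume ab: "a < b \<and> b \<le> \<sigma> b" and "\<not> \<sigma> a < \<sigma> b"
    then have gt: "\<sigma> b < \<sigma> a" using involution_eq_iff[OF inv, of a b] by linarith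
    define t where "t = transpose a b"
    define \<tau> where "\<tau> = (\<lambda>i. t (\<sigma> (t i)))"
    have tt: "t (t i) = i" for i by (simp add: t_def)
    have nonclosers: "a \<notin> D" "b \<notin> D" using ab gt closers by (auto simp: closers_def)
    have t_D: "t d = d" if "d \<in> D" for d
      using that nonclosers by (metis t_def transpose_apply_other)
    have sa: "\<sigma> a \<in> D" "\<sigma> (\<sigma> a) = a"
      using ab gt closers involution_twice[OF inv, of a] by (auto simp: closers_def)
    have "a \<in> {1..n}" using closers_subset[OF inv] involution_in_iff[OF inv, of a] sa closers by blast
    moreover have "\<sigma> a \<in> {1..n}" using closers_subset[OF inv] sa closers by blast
    ultimately have range: "a \<in> {1..n}" "b \<in> {1..n}" using ab gt by auto
    have inv_\<tau>: "involution_of_length n \<tau>" unfolding involution_of_length_iff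
    proof (intro conjI allI impI)
      show "\<tau> (\<tau> x) = x" for x by (simp add: \<tau>_def tt involution_twice[OF inv])
      show "\<tau> x = x" if "x \<notin> {1..n}" for x
      proof -
        have "t x = x" using that range by (metis t_def transpose_apply_other)
        then show ?thesis using that inv by (simp add: \<tau>_def involution_of_length_iff)
      qed
    qed
    have \<tau>_D: "\<tau> d = t (\<sigma> d)" if "d \<in> D" for d using that by (simp add: \<tau>_def t_D)
    have closers_\<tau>: "closers \<tau> = D"
    proof (intro equalityI subsetI)
      fix i assume "i \<in> D"
      then have "\<sigma> i < i" "\<sigma> i \<noteq> \<sigma> (\<sigma> a) \<or> i = \<sigma> a"
        using closers by (auto simp: closers_def involution_eq_iff[OF inv])
      then show "i \<in> closers \<tau>"
        using ab gt \<tau>_D[OF \<open>i \<in> D\<close>] sa by (auto simp: closers_def t_def transpose_def)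
    next
      fix i assume i: "i \<in> closers \<tau>"
      show "i \<in> D"
      proof (rule ccontr)
        assume "i \<notin> D"
        then have le: "i \<le> \<sigma> i" using closers by (auto simp: closers_def)
        have "i \<le> \<tau> i"
          using le ab gt involution_eq_iff[OF inv] involution_twice[OF inv, of a]
            involution_twice[OF inv, of b]
          by (auto simp: \<tau>_def t_def transpose_def)
        then show False using i by (simp add: closers_def)
      qed
    qed
    have "w \<sigma> < w \<tau>"
    proof -
      let ?p = "\<sigma> a" and ?q = "\<sigma> b"
      have split: "w \<rho> = (\<Sum>d\<in>D \<inter> {?p, ?q}. d * \<rho> d) + (\<Sum>d\<in>D - {?p, ?q}. d * \<rho> d)" for \<rho>
        unfolding w_def by (rule sum.Int_Diff[OF finD])
      have "\<tau> d = \<sigma> d" if "d \<in> D - {?p, ?q}" for d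
      proof -
        have "\<sigma> d \<noteq> a" "\<sigma> d \<noteq> b" using that involution_twice[OF inv, of d] by auto
        then show ?thesis using that \<tau>_D by (simp add: t_def)
      qed
      then have rest: "(\<Sum>d\<in>D - {?p, ?q}. d * \<tau> d) = (\<Sum>d\<in>D - {?p, ?q}. d * \<sigma> d)"
        by simp
      have \<tau>_p: "\<tau> ?p = b" "\<sigma> ?p = a"
        using sa \<tau>_D[OF sa(1)] by (simp_all add: t_def)
      have "(\<Sum>d\<in>D \<inter> {?p, ?q}. d * \<sigma> d) < (\<Sum>d\<in>D \<inter> {?p, ?q}. d * \<tau> d)"
      proof (cases "?q \<in> D")
        case True
        then have Int: "D \<inter> {?p, ?q} = {?p, ?q}" using sa by blast
        have \<tau>_q: "\<tau> ?q = a" "\<sigma> ?q = b"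
          using True \<tau>_D[OF True] involution_twice[OF inv, of b] by (simp_all add: t_def)
        obtain e where e: "b = a + e" "e > 0" using ab less_imp_add_positive by blast
        have "?q * e < ?p * e" using gt e by simp
        then have "?p * a + ?q * b < ?p * b + ?q * a" by (simp add: e algebra_simps)
        then show ?thesis using gt by (simp add: Int \<tau>_p \<tau>_q)
      next
        case False
        then have "D \<inter> {?p, ?q} = {?p}" using sa by blast
        then show ?thesis using ab gt by (simp add: \<tau>_p)
      qed
      then show ?thesis using split[of \<sigma>] split[of \<tau>] rest by simp
    qed
    then show False using maximal[of \<tau>] inv_\<tau> closers_\<tau> by (simp add: S_def)
  qed
  then show ?thesis using inv closers by blast
qed

lemma num_321_avoiding_involutions_eq_card_ballot_sets:
  assumes "m \<le> n"
  shows "num_321_avoiding_involutions n (int (n - m)) = card (ballot_sets n m)"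
proof -
  define S where "S = {\<sigma>. involution_of_length n \<sigma> \<and> avoids_321 n \<sigma> \<and>
    int (longest_increasing n \<sigma>) = int (n - m)}"
  have S: "\<sigma> \<in> S \<longleftrightarrow> involution_of_length n \<sigma> \<and> increasing_at_weak_excedances \<sigma> \<and> card (closers \<sigma>) = m"
    for \<sigma>
  proof (cases "involution_of_length n \<sigma>")
    case True
    then have "card (closers \<sigma>) \<le> n"
      using closers_subset[OF True] card_mono[of "{1..n}" "closers \<sigma>"] by simp
    with True assms show ?thesis
      by (auto simp: S_def avoids_321_iff longest_increasing_eq)
  qed (simp add: S_def)
  have "bij_betw closers S (ballot_sets n m)"
  proof (rule bij_betwI')
    show "closers \<sigma> = closers \<tau> \<longleftrightarrow> \<sigma> = \<tau>" if "\<sigma> \<in> S" "\<tau> \<in> S" for \<sigma> \<tau>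
      using that closers_determine_involution[of n \<sigma> \<tau>] unfolding S by blast
    show "closers \<sigma> \<in> ballot_sets n m" if "\<sigma> \<in> S" for \<sigma>
      using that closers_ballot[of n \<sigma>] unfolding S by auto
    show "\<exists>\<sigma>\<in>S. D = closers \<sigma>" if D: "D \<in> ballot_sets n m" for D
    proof -
      obtain \<sigma> where \<sigma>: "involution_of_length n \<sigma>" "increasing_at_weak_excedances \<sigma>" "closers \<sigma> = D"
        using increasing_involution_exists[OF D] by blast
      moreover have "card D = m" using D by (simp add: ballot_sets_def)
      ultimately have "\<sigma> \<in> S" unfolding S by simp
      then show ?thesis using \<sigma>(3) by blast
    qed
  qed
  then show ?thesis
    using bij_betw_same_card[of closers S "ballot_sets n m"]
    unfolding num_321_avoiding_involutions_def S_def by simp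
qed

section \<open>Counting ballot sets\<close>

lemma ballot_sets_0: "ballot_sets n 0 = {{}}"
  by (auto simp: ballot_sets_def finite_subset)

lemma ballot_sets_empty:
  assumes "n < 2 * m"
  shows "ballot_sets n m = {}"
proof -
  have False if "D \<in> ballot_sets n m" for D
  proof -
    have "D \<inter> {1..n} = D" "2 * card (D \<inter> {1..n}) \<le> n" "card D = m"
      using that by (auto simp: ballot_sets_def)
    then show False using assms by simp
  qed
  then show ?thesis by blast
qed

lemma finite_ballot_sets: "finite (ballot_sets n m)"
  by (rule finite_subset[of _ "Pow {1..n}"]) (auto simp: ballot_sets_def)

text \<open>
  The bound on \<open>m\<close> is what the ballot condition at \<open>j = n + 1\<close> requires when \<open>n + 1\<close> is added.
\<close>

lemma ballot_sets_Suc: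
  assumes "2 * Suc m \<le> Suc n"
  shows "ballot_sets (Suc n) (Suc m) = ballot_sets n (Suc m) \<union> insert (Suc n) ` ballot_sets n m"
proof (intro equalityI subsetI)
  fix D assume D: "D \<in> ballot_sets (Suc n) (Suc m)"
  then have fin: "finite D" by (auto simp: ballot_sets_def intro: finite_subset)
  show "D \<in> ballot_sets n (Suc m) \<union> insert (Suc n) ` ballot_sets n m"
  proof (cases "Suc n \<in> D")
    case False
    then have "D \<in> ballot_sets n (Suc m)" using D
      by (auto simp: ballot_sets_def subset_iff le_Suc_eq)
    then show ?thesis by blast
  next
    case True
    have "2 * card ((D - {Suc n}) \<inter> {1..j}) \<le> j" for j
      by (rule ballot_prefixes_Diff[OF fin]) (use D in \<open>simp add: ballot_sets_def\<close>)
    then have "D - {Suc n} \<in> ballot_sets n m"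
      using D True fin by (auto simp: ballot_sets_def le_Suc_eq)
    then show ?thesis using True by (metis UnI2 imageI insert_Diff)
  qed
next
  fix D assume "D \<in> ballot_sets n (Suc m) \<union> insert (Suc n) ` ballot_sets n m"
  then show "D \<in> ballot_sets (Suc n) (Suc m)"
  proof
    assume "D \<in> ballot_sets n (Suc m)"
    then show ?thesis by (auto simp: ballot_sets_def)
  next
    assume "D \<in> insert (Suc n) ` ballot_sets n m"
    then obtain D' where D': "D' \<in> ballot_sets n m" "D = insert (Suc n) D'" by blast
    then have sub: "D' \<subseteq> {1..n}" and card: "card D' = m"
      and ballot: "2 * card (D' \<inter> {1..j}) \<le> j" for j
      by (auto simp: ballot_sets_def)
    have card_D: "card D = Suc m"
      using sub card D'(2) finite_subset[OF sub] by (subst D'(2), subst card_insert_disjoint) auto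
    have "2 * card (D \<inter> {1..j}) \<le> j" for j
    proof (cases "j \<le> n")
      case True
      then have "D \<inter> {1..j} = D' \<inter> {1..j}" using D' by auto
      then show ?thesis using ballot by simp
    next
      case False
      have "2 * card (D \<inter> {1..j}) \<le> 2 * card D"
        by (intro mult_le_mono2 card_mono) (use D' sub finite_subset in auto)
      also have "\<dots> \<le> j" using False card_D assms by simp
      finally show ?thesis .
    qed
    then show ?thesis using D' sub card_D by (auto simp: ballot_sets_def)
  qed
qed

lemma card_ballot_sets_Suc:
  assumes "2 * Suc m \<le> Suc n"
  shows "card (ballot_sets (Suc n) (Suc m)) = card (ballot_sets n (Suc m)) + card (ballot_sets n m)"
proof -
  have not_in: "Suc n \<notin> D" if "D \<in> ballot_sets n k" for D k
    using that by (auto simp: ballot_sets_def)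
  have "card (insert (Suc n) ` ballot_sets n m) = card (ballot_sets n m)"
  proof (intro card_image inj_onI)
    fix x y assume "x \<in> ballot_sets n m" "y \<in> ballot_sets n m" "insert (Suc n) x = insert (Suc n) y"
    then show "x = y" using insert_ident[of "Suc n" x y] not_in by simp
  qed
  moreover have "ballot_sets n (Suc m) \<inter> insert (Suc n) ` ballot_sets n m = {}"
    using not_in by blast
  ultimately show ?thesis
    using assms by (simp add: ballot_sets_Suc card_Un_disjoint finite_ballot_sets)
qed

text \<open>
  This is the ballot number as a difference of binomial coefficients. The hypothesis also admits
  \<open>2 * (m + 1) = n + 1\<close>, where both binomial coefficients agree and there is no ballot set: the
  recurrence runs into this boundary case.
\<close>

lemma card_ballot_sets_add:
  assumes "2 * Suc m \<le> Suc n"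
  shows "card (ballot_sets n (Suc m)) + (n choose m) = n choose Suc m"
  using assms
proof (induction n arbitrary: m)
  case 0
  then show ?case by simp
next
  case (Suc n)
  show ?case
  proof (cases "2 * Suc m = Suc (Suc n)")
    case True
    then have "n = 2 * m" by simp
    then have "Suc n choose Suc m = Suc n choose m"
      using binomial_symmetric[of "Suc m" "Suc n"] by simp
    moreover have "ballot_sets (Suc n) (Suc m) = {}"
      by (rule ballot_sets_empty) (use True in simp)
    ultimately show ?thesis by simp
  next
    case False
    then have le: "2 * Suc m \<le> Suc n" using Suc.prems by simp
    show ?thesis
    proof (cases m)
      case 0
      have "card (ballot_sets (Suc n) (Suc 0)) = card (ballot_sets n (Suc 0)) + 1"
        using card_ballot_sets_Suc[of 0 n] le by (simp add: ballot_sets_0)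
      moreover have "card (ballot_sets n (Suc 0)) + 1 = n"
        using Suc.IH[of 0] le 0 by simp
      ultimately show ?thesis by (simp add: 0)
    next
      case (Suc k)
      then have "2 * Suc k \<le> Suc n" using le by simp
      then show ?thesis
        using card_ballot_sets_Suc[OF le] Suc.IH[OF le] Suc.IH[of k] Suc by simp
    qed
  qed
qed

text \<open>
  The product form, which keeps the factors that are separately log-concave apart.
\<close>

lemma card_ballot_sets:
  assumes "2 * m \<le> n"
  shows "real (Suc n) * real (card (ballot_sets n m)) =
    (real (Suc n) - 2 * real m) * real (Suc n choose m)"
proof (cases m)
  case 0
  then show ?thesis by (simp add: ballot_sets_0)
next
  case (Suc k)
  have "card (ballot_sets n m) + (n choose k) = n choose m"
    using card_ballot_sets_add[of k n] assms Suc by simp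
  then have diff: "real (card (ballot_sets n m)) = real (n choose m) - real (n choose k)"
    by (metis add_diff_cancel_right' of_nat_add)
  have "Suc n * (n choose k) = m * (Suc n choose m)"
    using Suc_times_binomial_eq[of n k] Suc by (simp only: mult.commute)
  moreover have "Suc n * (n choose m) = (Suc n - m) * (Suc n choose m)"
    using binomial_absorb_comp[of "Suc n" m] by simp
  ultimately have "real (Suc n) * real (n choose k) = real m * real (Suc n choose m)"
    "real (Suc n) * real (n choose m) = real (Suc n - m) * real (Suc n choose m)"
    by (metis of_nat_mult)+
  then show ?thesis using assms
    by (simp only: diff right_diff_distrib) (simp add: of_nat_diff algebra_simps)
qed

section \<open>Log-concavity\<close>

lemma binomial_log_concave:
  assumes "Suc m \<le> N"
  shows "real (N choose m) * real (N choose Suc (Suc m)) \<le> (real (N choose Suc m))\<^sup>2"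
proof -
  define x y z where "x = real (N choose m)" and "y = real (N choose Suc m)"
    and "z = real (N choose Suc (Suc m))"
  define r where "r = real N - real m"
  have eq: "Suc k * (N choose Suc k) = (N - k) * (N choose k)" for k
    using binomial_absorption[of k N] binomial_absorb_comp[of N k] by simp
  have "real (Suc m) * y = real (N - m) * x" unfolding x_def y_def
    by (metis eq of_nat_mult)
  then have y: "(real m + 1) * y = r * x" using assms by (simp add: r_def of_nat_diff algebra_simps)
  have "real (Suc (Suc m)) * z = real (N - Suc m) * y" unfolding z_def y_def
    by (metis eq of_nat_mult)
  then have z: "(real m + 2) * z = (r - 1) * y"
    using assms by (simp add: r_def of_nat_diff algebra_simps)
  have r: "r \<ge> 1" using assms by (simp add: r_def)
  have nonneg: "x \<ge> 0" "y \<ge> 0" "z \<ge> 0" by (simp_all add: x_def y_def z_def)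
  have "(r * x) * ((real m + 2) * z) = (real m + 1) * (r - 1) * y\<^sup>2"
    unfolding y[symmetric] z by (simp add: power2_eq_square)
  also have "\<dots> \<le> (real m + 2) * r * y\<^sup>2"
    using r by (intro mult_right_mono mult_mono) auto
  finally have "(r * (real m + 2)) * (x * z) \<le> (r * (real m + 2)) * y\<^sup>2"
    by (simp add: mult_ac)
  then have "x * z \<le> y\<^sup>2" using r by (simp add: mult_le_cancel_left_pos)
  then show ?thesis by (simp add: x_def y_def z_def)
qed

lemma card_ballot_sets_log_concave:
  assumes "2 * Suc (Suc m) \<le> n"
  shows "real (card (ballot_sets n m)) * real (card (ballot_sets n (Suc (Suc m))))
    \<le> (real (card (ballot_sets n (Suc m))))\<^sup>2"
proof -
  define N where "N = real (Suc n)"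
  define b where "b k = real (card (ballot_sets n k))" for k
  define c where "c k = real (Suc n choose k)" for k
  have b: "N * b k = (N - 2 * real k) * c k" if "2 * k \<le> n" for k
    using card_ballot_sets[OF that] by (simp add: N_def b_def c_def)
  \<comment> \<open>The linear factors at \<open>m\<close>, \<open>m + 1\<close>, \<open>m + 2\<close> are \<open>?s + 2\<close>, \<open>?s\<close>, \<open>?s - 2\<close>.\<close>
  let ?s = "N - 2 * real (Suc m)"
  have s: "?s \<ge> 2" using assms by (simp add: N_def)
  have "N\<^sup>2 * (b m * b (Suc (Suc m))) = (N * b m) * (N * b (Suc (Suc m)))"
    by (simp add: power2_eq_square)
  also have "\<dots> = ((?s + 2) * (?s - 2)) * (c m * c (Suc (Suc m)))"
    using assms by (simp add: b algebra_simps)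
  also have "\<dots> \<le> ?s\<^sup>2 * (c (Suc m))\<^sup>2"
  proof (rule mult_mono)
    show "(?s + 2) * (?s - 2) \<le> ?s\<^sup>2" by (simp add: power2_eq_square algebra_simps)
    show "c m * c (Suc (Suc m)) \<le> (c (Suc m))\<^sup>2"
      unfolding c_def by (rule binomial_log_concave) (use assms in simp)
  qed (auto simp: c_def)
  also have "\<dots> = (N * b (Suc m))\<^sup>2" using assms by (simp add: b power_mult_distrib)
  also have "\<dots> = N\<^sup>2 * (b (Suc m))\<^sup>2" by (simp add: power_mult_distrib)
  finally have "N\<^sup>2 * (b m * b (Suc (Suc m))) \<le> N\<^sup>2 * (b (Suc m))\<^sup>2" .
  then show ?thesis by (simp add: mult_le_cancel_left_pos N_def b_def)
qed

lemma card_ballot_sets_pos: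
  assumes "2 * m \<le> n"
  shows "card (ballot_sets n m) > 0"
proof -
  have "(real (Suc n) - 2 * real m) * real (Suc n choose m) > 0"
    using assms by (intro mult_pos_pos) (auto simp: zero_less_binomial_iff)
  then have "real (Suc n) * real (card (ballot_sets n m)) > 0"
    using card_ballot_sets[OF assms] by simp
  then show ?thesis by (simp add: zero_less_mult_iff)
qed

theorem corollary4p2:
  fixes n :: nat
  assumes "n \<ge> 1"
  shows "log_concave_on {k :: int. real n / 2 \<le> real_of_int k \<and> k \<le> int n}
           (\<lambda>k. real (num_321_avoiding_involutions n k))"
proof -
  let ?R = "{k :: int. real n / 2 \<le> real_of_int k \<and> k \<le> int n}"
  have in_R: "\<exists>m. k = int (n - m) \<and> 2 * m \<le> n \<and> m \<le> n" if "k \<in> ?R" for k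
  proof -
    have "int n \<le> 2 * k" "k \<le> int n" using that by auto
    then show ?thesis by (intro exI[of _ "nat (int n - k)"]) auto
  qed
  show ?thesis unfolding log_concave_on_def
  proof (intro conjI ballI allI impI)
    fix k assume "k \<in> ?R"
    then obtain m where "k = int (n - m)" "2 * m \<le> n" "m \<le> n" using in_R by blast
    then have "num_321_avoiding_involutions n k = card (ballot_sets n m)"
      by (simp only: num_321_avoiding_involutions_eq_card_ballot_sets)
    then show "0 < real (num_321_avoiding_involutions n k)"
      using card_ballot_sets_pos[OF \<open>2 * m \<le> n\<close>] by simp
  next
    fix k assume k: "k - 1 \<in> ?R \<and> k \<in> ?R \<and> k + 1 \<in> ?R"
    then obtain m where m: "k + 1 = int (n - m)" "m \<le> n" using in_R by blast
    obtain m' where m'_le: "k - 1 = int (n - m')" "2 * m' \<le> n" "m' \<le> n" using in_R k by blast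
    have "m' = Suc (Suc m)" using m m'_le by linarith
    then have m': "2 * Suc (Suc m) \<le> n" using m'_le by simp
    then have "k = int (n - Suc m)" "k - 1 = int (n - Suc (Suc m))"
      using m by (simp_all add: of_nat_diff)
    then have "num_321_avoiding_involutions n (k - 1) = card (ballot_sets n (Suc (Suc m)))"
      "num_321_avoiding_involutions n k = card (ballot_sets n (Suc m))"
      "num_321_avoiding_involutions n (k + 1) = card (ballot_sets n m)"
      using m m' by (simp_all only: num_321_avoiding_involutions_eq_card_ballot_sets)
    then show "real (num_321_avoiding_involutions n (k - 1)) * real (num_321_avoiding_involutions n (k + 1))
        \<le> (real (num_321_avoiding_involutions n k))\<^sup>2"
      using card_ballot_sets_log_concave[OF m'] by (simp add: mult.commute)
  qed
qed

end
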